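(* Let $K\ge1$ be an integer and let $p$ be an odd prime with $p\mid K^2+4$. Then the multiplicative order of $2^{-1}K$ modulo $p$ equals $4$, and $\pi_K(p)=4p$.
   Context: The $K$-Fibonacci sequence is $F_{K,0}=0$, $F_{K,1}=1$, $F_{K,n}=K F_{K,n-1}+F_{K,n-2}$; for an integer $m>1$, $\pi_K(m)$ is the length of its shortest period modulo $m$. Here $2^{-1}$ denotes the inverse of $2$ modulo $p$. *)

theory Defs
  imports "HOL-Number_Theory.Number_Theory"
begin

fun K_fib :: "int \<Rightarrow> nat \<Rightarrow> int" where
  "K_fib K 0 = 0"
| "K_fib K (Suc 0) = 1"
| "K_fib K (Suc (Suc n)) = K * K_fib K (Suc n) + K_fib K n"

text \<open>
  The recurrence is invertible modulo every \<open>m\<close>, so the reduced sequence is periodic from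
  index \<open>0\<close> onwards and a period may be required to hold at all indices; this also ensures that
  the set whose least element is taken is nonempty for \<open>m > 1\<close>.
\<close>
definition K_fib_period :: "int \<Rightarrow> int \<Rightarrow> nat" where
  "K_fib_period K m = (LEAST t. t > 0 \<and> (\<forall>n. [K_fib K (n + t) = K_fib K n] (mod m)))"

end

theory Submission
  imports Defs
begin

text \<open>
  Put \<open>a = 2\<^sup>-\<^sup>1 K\<close>. The hypothesis says \<open>a\<^sup>2 = -1\<close> modulo \<open>p\<close>, so \<open>a\<close> has order \<open>4\<close>, and the
  characteristic polynomial \<open>x\<^sup>2 - K x - 1\<close> of the recurrence becomes \<open>(x - a)\<^sup>2\<close>. Because of this
  double root the \<open>n\<close>-th term is \<open>n a\<^sup>n\<^sup>-\<^sup>1\<close>. The factor \<open>n\<close> has period \<open>p\<close> and the factor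
  \<open>a\<^sup>n\<^sup>-\<^sup>1\<close> has period \<open>4\<close>, which is coprime to \<open>p\<close>.
\<close>

lemma minus_one_power_cong_1_iff:
  fixes m :: int
  assumes "m > 2"
  shows "[(-1) ^ n = 1] (mod m) \<longleftrightarrow> even n"
proof (cases "even n")
  case False
  \<comment> \<open>For odd \<open>n\<close> the congruence would make \<open>m\<close> divide 1 -
    (-1) = 2.\<close>
  have "\<not> m dvd 2"
    using assms zdvd_not_zless[of 2 m] by simp
  with False show ?thesis
    by (simp add: cong_iff_dvd_diff)
qed simp

text \<open>Two parity steps: squaring \<open>a ^ n\<close> gives \<open>(-1) ^ n\<close>, which
  forces \<open>n = 2 * k\<close>; then \<open>a ^ n\<close> is itself \<open>(-1) ^ k\<close>,
  which forces \<open>k\<close> to be even.\<close>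

lemma sqrt_minus_one_power_cong_1_iff:
  fixes a m :: int
  assumes "m > 2" and a: "[a\<^sup>2 = -1] (mod m)"
  shows "[a ^ n = 1] (mod m) \<longleftrightarrow> 4 dvd n"
proof
  have sq: "[a ^ (2 * k) = (-1) ^ k] (mod m)" for k
    using cong_pow[OF a, of k] by (simp add: power_mult)
  {
    assume "[a ^ n = 1] (mod m)"
    then have *: "[a ^ (2 * n) = 1] (mod m)"
      using cong_pow[of "a ^ n" 1 m 2] by (simp add: power_mult[symmetric] mult.commute)
    have "even n"
      using minus_one_power_cong_1_iff[OF \<open>m > 2\<close>] cong_trans[OF cong_sym[OF sq] *] by blast
    then obtain k where k: "n = 2 * k" ..
    have "even k"
      using minus_one_power_cong_1_iff[OF \<open>m > 2\<close>] cong_trans[OF cong_sym[OF sq]]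
        \<open>[a ^ n = 1] (mod m)\<close> k by blast
    then show "4 dvd n"
      using k by auto
  next
    assume "4 dvd n"
    then obtain k where "n = 2 * (2 * k)"
      by auto
    then show "[a ^ n = 1] (mod m)"
      using sq[of "2 * k"] by simp
  }
qed

lemma ord_sqrt_minus_one:
  fixes a m :: int
  assumes "m > 2" and "[a\<^sup>2 = -1] (mod m)" and "coprime m a"
  shows "ord m a = 4"
proof -
  have "(LEAST d. 0 < d \<and> [a ^ d = 1] (mod m)) = 4"
    by (rule Least_equality)
      (use assms in \<open>auto simp: sqrt_minus_one_power_cong_1_iff dest: dvd_imp_le\<close>)
  \<comment> \<open>\<open>ord\<close> is this least exponent only for coprime arguments, and 0
    otherwise.\<close>
  then show ?thesis
    using \<open>coprime m a\<close> by (simp add: ord_def)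
qed

text \<open>Indexing by \<open>Suc n\<close> avoids the exponent n - 1 at index 0.\<close>

lemma K_fib_double_root_cong:
  fixes a K m :: int
  assumes K: "[K = 2 * a] (mod m)" and a: "[a\<^sup>2 = -1] (mod m)"
  shows "[K_fib K (Suc n) = int (Suc n) * a ^ n] (mod m)"
proof (induction n rule: induct_nat_012)
  case 0
  show ?case by simp
next
  case 1
  show ?case using K by simp
next
  case (ge2 n)
  have "[K_fib K (Suc (Suc (Suc n))) =
      2 * a * (int (Suc (Suc n)) * a ^ Suc n) + int (Suc n) * a ^ n] (mod m)"
    unfolding K_fib.simps(3)[of K "Suc n"] by (intro cong_add cong_mult K ge2)
  \<comment> \<open>The deviation from the closed form is isolated as a multiple of a^2 + 1, which
    vanishes modulo \<open>m\<close>.\<close>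
  also have "2 * a * (int (Suc (Suc n)) * a ^ Suc n) + int (Suc n) * a ^ n =
      int (Suc (Suc (Suc n))) * a ^ Suc (Suc n) + (a\<^sup>2 - (-1)) * (int (Suc n) * a ^ n)"
    by (simp add: algebra_simps power2_eq_square)
  also have "[\<dots> = int (Suc (Suc (Suc n))) * a ^ Suc (Suc n) + 0] (mod m)"
    using a by (intro cong_add cong_refl) (simp add: cong_iff_dvd_diff)
  finally show ?case by simp
qed

lemma K_fib_double_root_period:
  fixes a K p :: int
  assumes "prime p" and "p > 2"
    and K: "[K = 2 * a] (mod p)" and a: "[a\<^sup>2 = -1] (mod p)" and "coprime a p"
  shows "int (K_fib_period K p) = 4 * p"
proof -
  note F = K_fib_double_root_cong[OF K a]
  note a_power = sqrt_minus_one_power_cong_1_iff[OF \<open>p > 2\<close> a]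
  have "(LEAST t. t > 0 \<and> (\<forall>n. [K_fib K (n + t) = K_fib K n] (mod p))) = nat (4 * p)"
  proof (rule Least_equality, intro conjI allI)
    show "nat (4 * p) > 0"
      using \<open>p > 2\<close> by simp
  next
    fix n
    \<comment> \<open>The extra factor \<open>a\<close> gives a formula valid at index 0 too; it is
      cancelled at the end, being a unit modulo \<open>p\<close>.\<close>
    have aF: "[a * K_fib K k = int k * a ^ k] (mod p)" for k
    proof (cases k)
      case (Suc j)
      then show ?thesis
        using cong_scalar_left[OF F[of j], of a] by (simp add: algebra_simps)
    qed simp
    have "4 dvd nat (4 * p)"
      using \<open>p > 2\<close> by (simp add: nat_mult_distrib)
    then have 1: "[a ^ nat (4 * p) = 1] (mod p)"
      by (simp add: a_power)
    have 2: "[int (n + nat (4 * p)) = int n] (mod p)"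
      using \<open>p > 2\<close> by (simp add: cong_iff_dvd_diff)
    have "[a * K_fib K (n + nat (4 * p)) = int (n + nat (4 * p)) * a ^ (n + nat (4 * p))] (mod p)"
      by (rule aF)
    also have "[int (n + nat (4 * p)) * a ^ (n + nat (4 * p)) = int n * (a ^ n * 1)] (mod p)"
      unfolding power_add by (intro cong_mult cong_refl 1 2)
    also have "[int n * (a ^ n * 1) = a * K_fib K n] (mod p)"
      using cong_sym[OF aF] by simp
    finally show "[K_fib K (n + nat (4 * p)) = K_fib K n] (mod p)"
      using cong_mult_lcancel[OF \<open>coprime a p\<close>] by blast
  next
    fix t :: nat
    assume t: "0 < t \<and> (\<forall>n. [K_fib K (n + t) = K_fib K n] (mod p))"
    then obtain s where s: "t = Suc s"
      by (auto simp: gr0_conv_Suc)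
    \<comment> \<open>Minimality needs the period at two indices only. Index 0 yields
      \<open>p dvd int t\<close>, since powers of \<open>a\<close> are units.\<close>
    have "[K_fib K t = 0] (mod p)"
      using spec[OF conjunct2[OF t], of 0] by simp
    then have "p dvd int t * a ^ s"
      using F[of s] unfolding s by (metis cong_0_iff cong_dvd_iff)
    moreover have "coprime p (a ^ s)"
      using \<open>coprime a p\<close> by (simp add: coprime_commute)
    ultimately have p_dvd: "p dvd int t"
      by (simp add: coprime_dvd_mult_left_iff)
    \<comment> \<open>Index 1 yields \<open>4 dvd t\<close>: as \<open>p\<close> divides
      \<open>t\<close>, the factor t + 1 is 1 modulo \<open>p\<close>, leaving a^t = 1.\<close>
    have "[a ^ t = int (Suc t) * a ^ t] (mod p)"
      using p_dvd by (simp add: cong_iff_dvd_diff algebra_simps)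
    also have "[int (Suc t) * a ^ t = K_fib K (1 + t)] (mod p)"
      using cong_sym[OF F[of t]] by simp
    also have "[K_fib K (1 + t) = 1] (mod p)"
      using spec[OF conjunct2[OF t], of 1] by simp
    finally have "4 dvd t"
      by (simp add: a_power)
    then have four_dvd: "4 dvd int t"
      by presburger
    have "odd p"
      using \<open>prime p\<close> \<open>p > 2\<close> prime_odd_int by blast
    then have "coprime (2 ^ 2) p"
      by (subst coprime_power_left_iff) simp
    then have "coprime 4 p"
      by simp
    then have "4 * p dvd int t"
      using four_dvd p_dvd by (simp add: divides_mult)
    then show "nat (4 * p) \<le> t"
      using zdvd_imp_le t by fastforce
  qed
  then show ?thesis
    using \<open>p > 2\<close> by (simp add: K_fib_period_def)
qed

theorem theorem2p7:
  fixes K p :: int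
  assumes "K \<ge> 1" and "prime p" and "odd p" and "p dvd K\<^sup>2 + 4"
  shows "ord p (modular_inverse p 2 * K) = 4 \<and> int (K_fib_period K p) = 4 * p"
proof -
  define a where "a = modular_inverse p 2 * K"
  have "p > 2"
    using \<open>prime p\<close> \<open>odd p\<close> prime_ge_2_int[of p] by (cases "p = 2") auto
  have "coprime 2 p"
    using \<open>odd p\<close> by simp
  from cong_scalar_right[OF cong_modular_inverse1[OF this], of K]
  have K: "[2 * a = K] (mod p)"
    by (simp add: a_def mult.assoc)
  \<comment> \<open>Modulo \<open>p\<close>, 4 a^2 = K^2 = -4, and 4 can be cancelled because
    \<open>p\<close> is odd.\<close>
  have "[2\<^sup>2 * a\<^sup>2 = K\<^sup>2] (mod p)"
    using cong_pow[OF K, of 2] by (simp add: power_mult_distrib)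
  also have "[K\<^sup>2 = 2\<^sup>2 * (-1)] (mod p)"
    using \<open>p dvd K\<^sup>2 + 4\<close> by (simp add: cong_iff_dvd_diff)
  finally have a: "[a\<^sup>2 = -1] (mod p)"
    using cong_mult_lcancel[of "2\<^sup>2" p] \<open>coprime 2 p\<close> by (metis coprime_power_left_iff)
  \<comment> \<open>The square of \<open>a\<close> is congruent to the unit -1, so \<open>a\<close>
    is a unit too.\<close>
  have "coprime (a\<^sup>2) p"
    using cong_imp_coprime[OF cong_sym[OF a]] by simp
  then have "coprime a p"
    by simp
  then show ?thesis
    using ord_sqrt_minus_one[OF \<open>p > 2\<close> a]
      K_fib_double_root_period[OF \<open>prime p\<close> \<open>p > 2\<close> cong_sym[OF K] a]
    by (simp add: a_def coprime_commute)
qed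

end
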